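(* Let $N>K\ge 2$ and let $X=(x_1,x_2,\dots,x_K)$ be a real $N\times K$ matrix of rank $K$ with first column $x_1=e=(1,\dots,1)'$. For $k=2,\dots,K$ let $q_k^2$, $\check R_k^2$, $I_k=1/(1-q_k^2)$, $C_k=1/(1-\check R_k^2)$ and $H_k=I_k C_k$ be as defined in the context. Then: (i) For each given $k\ge 2$, $H_k=1$ if and only if $\bar x_k=0$ and $x_i'x_k=0$ for every $i\ne k$ ($1\le i\le K$). (ii) Consequently, $H_k=1$ for every $k\in\{2,\dots,K\}$ if and only if both of the following hold: (1) $\bar x_k=0$ for every $k\ge 2$; (2) $X'X=\mathrm{diag}\{a_1,a_2,\dots,a_K\}$, where $a_1=N$ and $a_i=x_i'x_i$. (iii) If (2) holds (without (1) being assumed), then $H_k=I_k=1/(1-q_k^2)$ for every $k\ge 2$.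
   Context: Notation: a prime denotes transpose, and $x_k=(x_{1k},\dots,x_{Nk})'$. For $k\ge 2$, put $\bar x_k=\frac1N\sum_{n=1}^N x_{nk}$ and $s_{xk}^2=\frac1N\sum_{n=1}^N (x_{nk}-\bar x_k)^2$ (positive, by the rank assumption). The squared raw correlation of $x_k$ with $e$ is $q_k^2=(x_k'e)^2/[(x_k'x_k)(e'e)]$. $\check X_k$ denotes the $N\times(K-1)$ matrix obtained from $X$ by deleting the column $x_k$ (so $e$ is a column of $\check X_k$). $\check R_k^2$ is the coefficient of determination when $x_k$ is regressed by ordinary least squares on $\check X_k$: with $\check M_k=\check X_k(\check X_k'\check X_k)^{-1}\check X_k'$, $M_e=e(e'e)^{-1}e'$ and $\hat x_k=\check M_k x_k$, $$\check R_k^2=\frac{\hat x_k'(I-M_e)\hat x_k}{x_k'(I-M_e)x_k}.$$ By the rank assumption $q_k^2<1$ and $\check R_k^2<1$. The inefficiency index is $I_k=\frac{\sum_{n=1}^N x_{nk}^2}{N s_{xk}^2}=\frac{1}{1-q_k^2}$, the collinearity index (variance inflation factor) is $C_k=\frac{1}{1-\check R_k^2}$, and $H_k=I_kC_k$. *)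

theory Defs
  imports
    "Jordan_Normal_Form.DL_Rank"
    "Jordan_Normal_Form.Gauss_Jordan_Elimination"
    Complex_Main
begin

text \<open>
  Rows and columns are numbered from 0: column \<open>x\<^sub>k\<close> of the usual 1-based notation is
  \<open>col X (k - 1)\<close>, and the constant column \<open>e\<close> is \<open>col X 0\<close>.
\<close>

definition ones_vec :: "nat \<Rightarrow> real vec" where
  "ones_vec N = vec N (\<lambda>_. 1)"

definition sample_mean :: "real vec \<Rightarrow> real" where
  "sample_mean x = (\<Sum>n<dim_vec x. x $ n) / real (dim_vec x)"

definition sample_var :: "real vec \<Rightarrow> real" where
  "sample_var x = (\<Sum>n<dim_vec x. (x $ n - sample_mean x)\<^sup>2) / real (dim_vec x)"

text \<open>The squared uncentred correlation of \<open>x\<close> with the constant vector.\<close>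

definition raw_corr_sq :: "real vec \<Rightarrow> real" where
  "raw_corr_sq x =
     (let e = ones_vec (dim_vec x) in (x \<bullet> e)\<^sup>2 / ((x \<bullet> x) * (e \<bullet> e)))"

text \<open>
  The matrix \<open>A (A' A)\<^sup>-\<^sup>1 A'\<close>. \<^const>\<open>mat_inverse\<close> returns \<^const>\<open>None\<close> on singular
  matrices, so this is meaningful only if \<open>A\<close> has full column rank.
\<close>

definition hat_mat :: "real mat \<Rightarrow> real mat" where
  "hat_mat A = A * the (mat_inverse (transpose_mat A * A)) * transpose_mat A"

definition delete_col :: "'a mat \<Rightarrow> nat \<Rightarrow> 'a mat" where
  "delete_col X k =
     mat_of_cols (dim_row X) (map (col X) (filter (\<lambda>j. j \<noteq> k) [0..<dim_col X]))"

text \<open>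
  The (centred) coefficient of determination of the least squares regression of \<open>col X k\<close>
  on the other columns of \<open>X\<close>; \<open>Q\<close> is \<open>I - e (e' e)\<^sup>-\<^sup>1 e'\<close>, i.e. subtraction of the sample mean.
\<close>

definition aux_R_sq :: "real mat \<Rightarrow> nat \<Rightarrow> real" where
  "aux_R_sq X k =
     (let N = dim_row X;
          x = col X k;
          xh = hat_mat (delete_col X k) *\<^sub>v x;
          Q = 1\<^sub>m N - hat_mat (mat_of_cols N [ones_vec N])
      in (xh \<bullet> (Q *\<^sub>v xh)) / (x \<bullet> (Q *\<^sub>v x)))"

definition ineff_index :: "real mat \<Rightarrow> nat \<Rightarrow> real" where
  "ineff_index X k =
     (\<Sum>n<dim_row X. (X $$ (n, k))\<^sup>2) / (real (dim_row X) * sample_var (col X k))"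

definition collin_index :: "real mat \<Rightarrow> nat \<Rightarrow> real" where
  "collin_index X k = 1 / (1 - aux_R_sq X k)"

definition H_index :: "real mat \<Rightarrow> nat \<Rightarrow> real" where
  "H_index X k = ineff_index X k * collin_index X k"

lemma ineff_index_eq_raw_corr:
  assumes k: "k < dim_col X" and nz: "col X k \<noteq> 0\<^sub>v (dim_row X)"
  shows "ineff_index X k = 1 / (1 - raw_corr_sq (col X k))"
proof -
  define N where "N = dim_row X"
  define f where "f n = X $$ (n, k)" for n
  define S where "S = (\<Sum>n<N. f n)"
  define T where "T = (\<Sum>n<N. (f n)\<^sup>2)"
  have cf: "col X k $ n = f n" if "n < N" for n
    using that k by (simp add: f_def N_def)
  obtain m where m: "m < N" "f m \<noteq> 0"
    using nz cf by (metis N_def dim_col eq_vecI index_zero_vec)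
  then have N: "real N > 0" by simp
  have T: "T > 0"
    unfolding T_def using m by (intro sum_pos2[of _ m]) auto
  have mean: "sample_mean (col X k) = S / N"
    unfolding sample_mean_def S_def using cf by (simp add: N_def[symmetric])
  have "(\<Sum>n<N. (f n - S / N)\<^sup>2) = (\<Sum>n<N. (f n)\<^sup>2 - 2 * (S / N) * f n + (S / N)\<^sup>2)"
    by (simp add: power2_diff algebra_simps)
  also have "\<dots> = T - 2 * (S / N) * S + N * (S / N)\<^sup>2"
    by (simp add: sum.distrib sum_subtractf sum_distrib_left sum_distrib_right sum_divide_distrib
        T_def S_def mult.assoc)
  also have "\<dots> = T - S\<^sup>2 / N"
    using N by (simp add: field_simps power2_eq_square)
  finally have var: "N * sample_var (col X k) = T - S\<^sup>2 / N"
    unfolding sample_var_def using cf mean N by (simp add: N_def[symmetric])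
  have "raw_corr_sq (col X k) = S\<^sup>2 / (T * N)"
    using cf
    by (simp add: raw_corr_sq_def Let_def ones_vec_def scalar_prod_def S_def T_def
        N_def[symmetric] atLeast0LessThan power2_eq_square)
  moreover have "ineff_index X k = T / (T - S\<^sup>2 / N)"
    using var by (simp add: ineff_index_def T_def f_def N_def)
  moreover have "T - S\<^sup>2 / N = T * (1 - S\<^sup>2 / (T * N))"
    using T N by (simp add: field_simps)
  ultimately show ?thesis using T by simp
qed

end

theory Submission
  imports Defs
begin

text \<open>For A of full column rank, \<open>hat_mat A\<close> is the orthogonal projection onto
  the column space of A: its values lie in that space and satisfy the normal equations
  (\<open>hat_mat_in_range\<close>). Let h be the projection of x = x_k onto the span of the other
  columns. The vector e is one of these columns, so the residual x - h is orthogonal to e, and x and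
  h have the same coordinate sum S. Centring therefore lowers both squared norms by the same amount
  S^2/N. With D = x'x - S^2/N this gives I_k = x'x / D and C_k = D / (x'x - h'h), hence H_k = x'x /
  (x'x - h'h) (\<open>H_index_eq\<close>). The denominator is the squared length of the residual,
  positive because the columns are independent.

  So H_k = 1 exactly when h = 0, that is, when x_k is orthogonal to all other columns
  (\<open>hat_mat_eq_0_iff\<close>, \<open>H_index_eq_1_iff\<close>). Orthogonality to e is the
  vanishing of the mean, which gives (i). Imposed for all k, orthogonality says that the
  off-diagonal entries of X'X vanish, which gives (ii). Under (2), x_k is orthogonal to e and to
  every other column, so H_k and I_k both equal 1, which gives (iii).\<close>

lemma scalar_prod_self_nonneg: "0 \<le> v \<bullet> v" for v :: "real vec"
  by (simp add: scalar_prod_def sum_nonneg)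

lemma scalar_prod_self_eq_0_iff:
  "v \<bullet> v = 0 \<longleftrightarrow> v = 0\<^sub>v n" if "v \<in> carrier_vec n" for v :: "real vec"
  using conjugate_square_eq_0_vec[OF that] by simp

text \<open>The rank is the size of a maximal independent subset of the set of columns, and a
  repeated column would make that set too small. Independence is stated for this set, which forgets
  repetitions, so distinctness has to be derived separately.\<close>

lemma (in vec_space) full_rank_distinct_cols:
  assumes A: "A \<in> carrier_mat n nc" and "rank A = nc"
  shows "distinct (cols A)"
proof -
  obtain S where S: "maximal S (\<lambda>T. T \<subseteq> set (cols A) \<and> lin_indpt T)"
    using maximal_exists[of "\<lambda>T. T \<subseteq> set (cols A) \<and> lin_indpt T" "card (set (cols A))" "{}"]
    by (meson List.finite_set card_mono empty_iff empty_subsetI finite_lin_indpt2 rev_finite_subset)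
  then have "card S \<le> card (set (cols A))"
    by (simp add: card_mono maximal_def)
  moreover have "card S = length (cols A)"
    using rank_card_indpt[OF A S] assms by simp
  ultimately show ?thesis
    by (metis card_distinct card_length le_antisym)
qed

section \<open>Orthogonal projection onto the column space of a matrix\<close>

text \<open>Full column rank is encoded as a trivial kernel, the form in which the Gram matrix
  argument uses it. The instances are X with one column deleted and the single column e.\<close>

locale full_col_rank =
  fixes A :: "real mat" and n m :: nat
  assumes A: "A \<in> carrier_mat n m"
    and inj: "\<And>w. w \<in> carrier_vec m \<Longrightarrow> A *\<^sub>v w = 0\<^sub>v n \<Longrightarrow> w = 0\<^sub>v m"
begin

text \<open>If A'Aw = 0 then |Aw|^2 = w'A'Aw = 0, so w lies in the kernel of A.\<close>

lemma det_gram_nonzero: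
  shows "det (transpose_mat A * A) \<noteq> 0"
proof
  assume "det (transpose_mat A * A) = 0"
  then obtain w where w: "w \<in> carrier_vec m" "w \<noteq> 0\<^sub>v m"
    and 0: "(transpose_mat A * A) *\<^sub>v w = 0\<^sub>v m"
    using det_0_iff_vec_prod_zero[of "transpose_mat A * A" m] A by auto
  have "(A *\<^sub>v w) \<bullet> (A *\<^sub>v w) = (transpose_mat A *\<^sub>v (A *\<^sub>v w)) \<bullet> w"
    using transpose_vec_mult_scalar[OF A w(1)] A w by simp
  also have "transpose_mat A *\<^sub>v (A *\<^sub>v w) = 0\<^sub>v m"
    using 0 A w by (simp add: assoc_mult_mat_vec[of _ m n _ m])
  finally have "A *\<^sub>v w = 0\<^sub>v n"
    using scalar_prod_self_eq_0_iff[of "A *\<^sub>v w" n] A w by simp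
  with inj w show False by blast
qed

lemma gram_inverse:
  obtains G where "mat_inverse (transpose_mat A * A) = Some G" "G \<in> carrier_mat m m"
    "transpose_mat A * A * G = 1\<^sub>m m"
proof -
  have AA: "transpose_mat A * A \<in> carrier_mat m m" using A by simp
  have "det (transpose_mat A * A) \<noteq> 0" by (rule det_gram_nonzero)
  then obtain G where "mat_inverse (transpose_mat A * A) = Some G"
    using mat_inverse(1)[OF AA] det_non_zero_imp_unit[OF AA] by (metis option.exhaust)
  then show thesis using mat_inverse(2)[OF AA] that by blast
qed

lemma hat_mat_carrier [simp]: "hat_mat A \<in> carrier_mat n n"
  by (rule gram_inverse) (use A in \<open>simp add: hat_mat_def\<close>)

text \<open>These two facts characterise the projection: the value is a combination of the columns,
  and it solves the normal equations. Later arguments rest on them instead of the explicit formula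
  for \<open>hat_mat\<close>.\<close>

lemma hat_mat_in_range:
  assumes v: "v \<in> carrier_vec n"
  obtains w where "w \<in> carrier_vec m" "hat_mat A *\<^sub>v v = A *\<^sub>v w"
    "transpose_mat A *\<^sub>v (hat_mat A *\<^sub>v v) = transpose_mat A *\<^sub>v v"
proof -
  obtain G where G: "mat_inverse (transpose_mat A * A) = Some G" "G \<in> carrier_mat m m"
    and inv: "transpose_mat A * A * G = 1\<^sub>m m"
    by (rule gram_inverse)
  define w where "w = G *\<^sub>v (transpose_mat A *\<^sub>v v)"
  have At: "transpose_mat A \<in> carrier_mat m n" using A by simp
  have Atv: "transpose_mat A *\<^sub>v v \<in> carrier_vec m" using A v by simp
  have w: "w \<in> carrier_vec m" using G(2) Atv by (simp add: w_def)
  have hv: "hat_mat A *\<^sub>v v = A *\<^sub>v w"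
    using A G v At by (simp add: hat_mat_def w_def assoc_mult_mat_vec[of _ n m _ n]
        assoc_mult_mat_vec[of _ n m _ m])
  have "transpose_mat A *\<^sub>v (A *\<^sub>v w) = (transpose_mat A * A) *\<^sub>v w"
    by (rule assoc_mult_mat_vec[OF At A w, symmetric])
  also have "\<dots> = (transpose_mat A * A * G) *\<^sub>v (transpose_mat A *\<^sub>v v)"
    unfolding w_def using At A G(2) Atv by (intro assoc_mult_mat_vec[symmetric]) auto
  also have "\<dots> = transpose_mat A *\<^sub>v v" using inv Atv by simp
  finally show thesis using that w hv by simp
qed

lemma transpose_hat_mat:
  "transpose_mat A *\<^sub>v (hat_mat A *\<^sub>v v) = transpose_mat A *\<^sub>v v" if "v \<in> carrier_vec n"
  using hat_mat_in_range[OF that] by metis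

text \<open>With h = Aw, the normal equations give v'h = (A'v)'w = (A'h)'w = h'h. Equivalently, the
  residual v - h is orthogonal to h.\<close>

lemma scalar_prod_hat_mat:
  assumes v: "v \<in> carrier_vec n"
  shows "v \<bullet> (hat_mat A *\<^sub>v v) = (hat_mat A *\<^sub>v v) \<bullet> (hat_mat A *\<^sub>v v)"
proof -
  obtain w where w: "w \<in> carrier_vec m" "hat_mat A *\<^sub>v v = A *\<^sub>v w"
    "transpose_mat A *\<^sub>v (A *\<^sub>v w) = transpose_mat A *\<^sub>v v"
    using hat_mat_in_range[OF v] by metis
  have "v \<bullet> (A *\<^sub>v w) = (transpose_mat A *\<^sub>v v) \<bullet> w"
    by (rule transpose_vec_mult_scalar[OF A w(1) v, symmetric])
  also have "\<dots> = (A *\<^sub>v w) \<bullet> (A *\<^sub>v w)"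
    using transpose_vec_mult_scalar[OF A w(1), of "A *\<^sub>v w"] w A by simp
  finally show ?thesis using w by simp
qed

text \<open>Pythagoras, from v'h = h'h. The first form yields signs; the second evaluates the
  quadratic forms that occur in \<open>aux_R_sq\<close>.\<close>

lemma residual_norm:
  assumes v: "v \<in> carrier_vec n"
  defines "h \<equiv> hat_mat A *\<^sub>v v"
  shows "(v - h) \<bullet> (v - h) = v \<bullet> v - h \<bullet> h"
    "v \<bullet> ((1\<^sub>m n - hat_mat A) *\<^sub>v v) = v \<bullet> v - h \<bullet> h"
proof -
  have h: "h \<in> carrier_vec n" unfolding h_def by (rule mult_mat_vec_carrier[OF hat_mat_carrier v])
  have vh: "v \<bullet> h = h \<bullet> h" unfolding h_def by (rule scalar_prod_hat_mat[OF v])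
  show "(v - h) \<bullet> (v - h) = v \<bullet> v - h \<bullet> h"
  proof -
    have "h \<bullet> v = h \<bullet> h" using vh comm_scalar_prod[OF v h] by simp
    moreover have "(v - h) \<bullet> (v - h) = v \<bullet> v - v \<bullet> h - (h \<bullet> v - h \<bullet> h)"
      using v h by (simp add: minus_scalar_prod_distrib[of _ n] scalar_prod_minus_distrib[of _ n])
    ultimately show ?thesis using vh by simp
  qed
  show "v \<bullet> ((1\<^sub>m n - hat_mat A) *\<^sub>v v) = v \<bullet> v - h \<bullet> h"
    using v h vh by (simp add: minus_mult_distrib_mat_vec[of _ n n] h_def[symmetric]
        scalar_prod_minus_distrib[of _ n])
qed

text \<open>Both directions come from A'h = A'v with h = Aw: if h = 0 then A'v = 0, and if A'v = 0
  then h'h = (A'h)'w = 0.\<close>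

lemma hat_mat_eq_0_iff:
  assumes v: "v \<in> carrier_vec n"
  shows "hat_mat A *\<^sub>v v = 0\<^sub>v n \<longleftrightarrow> (\<forall>j<m. col A j \<bullet> v = 0)"
proof -
  obtain w where w: "w \<in> carrier_vec m" "hat_mat A *\<^sub>v v = A *\<^sub>v w"
    "transpose_mat A *\<^sub>v (A *\<^sub>v w) = transpose_mat A *\<^sub>v v"
    using hat_mat_in_range[OF v] by metis
  have "transpose_mat A *\<^sub>v v = 0\<^sub>v m \<longleftrightarrow> (\<forall>j<m. col A j \<bullet> v = 0)"
    using A by (auto simp: vec_eq_iff)
  moreover have "transpose_mat A *\<^sub>v v = 0\<^sub>v m" if "A *\<^sub>v w = 0\<^sub>v n"
  proof -
    have "transpose_mat A *\<^sub>v 0\<^sub>v n = 0\<^sub>v m" using A by (auto simp: vec_eq_iff)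
    with w(3) that show ?thesis by simp
  qed
  moreover have "A *\<^sub>v w = 0\<^sub>v n" if "transpose_mat A *\<^sub>v v = 0\<^sub>v m"
  proof -
    have "(A *\<^sub>v w) \<bullet> (A *\<^sub>v w) = 0"
      using transpose_vec_mult_scalar[OF A w(1), of "A *\<^sub>v w"] w that A by simp
    then show ?thesis using scalar_prod_self_eq_0_iff[of "A *\<^sub>v w" n] w A by simp
  qed
  ultimately show ?thesis using w by auto
qed

end

section \<open>Centring as projection onto the constant vector\<close>

lemma full_col_rank_ones:
  assumes "0 < N"
  shows "full_col_rank (mat_of_cols N [ones_vec N]) N 1"
proof
  fix w :: "real vec"
  assume w: "w \<in> carrier_vec 1" and 0: "mat_of_cols N [ones_vec N] *\<^sub>v w = 0\<^sub>v N"
  \<comment> \<open>Every row of the matrix is the single entry 1; a row 0 exists because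
    \<open>0 < N\<close>.\<close>
  have "(mat_of_cols N [ones_vec N] *\<^sub>v w) $ 0 = w $ 0"
    using assms w by (simp add: mat_of_cols_def scalar_prod_def ones_vec_def)
  then show "w = 0\<^sub>v 1" using 0 w assms by (auto simp: vec_eq_iff)
qed (simp add: mat_of_cols_def)

text \<open>The projection is c e for some scalar c, and the one normal equation e'(c e) = e'v
  forces c to be the mean of v.\<close>

lemma hat_mat_ones:
  assumes N: "0 < N" and v: "v \<in> carrier_vec N"
  shows "hat_mat (mat_of_cols N [ones_vec N]) *\<^sub>v v = ((ones_vec N \<bullet> v) / N) \<cdot>\<^sub>v ones_vec N"
proof -
  let ?E = "mat_of_cols N [ones_vec N]"
  interpret E: full_col_rank ?E N 1 by (rule full_col_rank_ones[OF N])
  obtain w where w: "w \<in> carrier_vec 1" "hat_mat ?E *\<^sub>v v = ?E *\<^sub>v w"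
    by (rule E.hat_mat_in_range[OF v])
  have e: "ones_vec N \<in> carrier_vec N" by (simp add: ones_vec_def)
  have ee: "ones_vec N \<bullet> ones_vec N = N" by (simp add: ones_vec_def scalar_prod_def)
  have Ew: "?E *\<^sub>v w = w $ 0 \<cdot>\<^sub>v ones_vec N"
    using w(1) by (auto simp: vec_eq_iff mat_of_cols_def scalar_prod_def ones_vec_def)
  have E0: "(transpose_mat ?E *\<^sub>v u) $ 0 = ones_vec N \<bullet> u" for u
    using e by (simp add: transpose_mat_of_cols)
  have "transpose_mat ?E *\<^sub>v (w $ 0 \<cdot>\<^sub>v ones_vec N) = transpose_mat ?E *\<^sub>v v"
    using E.transpose_hat_mat[OF v] w(2) Ew by (simp only:)
  from arg_cong[OF this, of "\<lambda>u. u $ 0"]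
  have "ones_vec N \<bullet> (w $ 0 \<cdot>\<^sub>v ones_vec N) = ones_vec N \<bullet> v"
    by (simp only: E0)
  then have "w $ 0 = (ones_vec N \<bullet> v) / N" using e ee N by (simp add: field_simps)
  with w Ew show ?thesis by simp
qed

section \<open>Deleting one column of X\<close>

lemma delete_col_carrier:
  assumes "X \<in> carrier_mat N K"
  shows "delete_col X k \<in> carrier_mat N (length (filter (\<lambda>j. j \<noteq> k) [0..<K]))"
  using assms by (intro carrier_matI) (simp_all add: delete_col_def)

lemma cols_delete_col:
  assumes "X \<in> carrier_mat N K"
  shows "cols (delete_col X k) = map (col X) (filter (\<lambda>j. j \<noteq> k) [0..<K])"
  using assms unfolding delete_col_def by (subst cols_mat_of_cols) auto

text \<open>The remaining columns form a subset of an independent set. An exact fit of x_k would put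
  it in their span, contradicting independence; this later makes the residual nonzero.\<close>

lemma delete_col_independent:
  fixes X :: "real mat"
  assumes X: "X \<in> carrier_mat N K" and rank: "vec_space.rank N X = K" and k: "k < K"
  defines "m \<equiv> length (filter (\<lambda>j. j \<noteq> k) [0..<K])"
  shows "full_col_rank (delete_col X k) N m"
    and "w \<in> carrier_vec m \<Longrightarrow> delete_col X k *\<^sub>v w \<noteq> col X k"
proof -
  interpret vec_space "TYPE(real)" N .
  let ?A = "delete_col X k"
  have A: "?A \<in> carrier_mat N m" unfolding m_def by (rule delete_col_carrier[OF X])
  have dX: "distinct (cols X)" by (rule full_rank_distinct_cols[OF X rank])
  have iX: "lin_indpt (set (cols X))" by (rule full_rank_lin_indpt[OF X rank dX])
  have colsX: "cols X = map (col X) [0..<K]" using X by (simp add: cols_def)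
  have inj: "inj_on (col X) {0..<K}" using dX by (simp add: colsX distinct_map)
  have dA: "distinct (cols ?A)"
    unfolding cols_delete_col[OF X]
    by (auto simp: distinct_map intro: inj_on_subset[OF inj])
  \<comment> \<open>Removing the index k removes the vector x_k from the set only because no other
    column equals it.\<close>
  have setA: "set (cols ?A) = set (cols X) - {col X k}"
    unfolding cols_delete_col[OF X] using k inj by (auto simp: colsX inj_on_def)
  have iA: "lin_indpt (set (cols ?A))"
    by (rule subset_li_is_li[OF iX]) (simp add: setA)
  show "full_col_rank ?A N m"
    using A lin_depI[OF A _ _ _ dA] iA by unfold_locales blast+
  assume w: "w \<in> carrier_vec m"
  show "?A *\<^sub>v w \<noteq> col X k"
  proof
    assume "?A *\<^sub>v w = col X k"
    then have "col X k \<in> col_space ?A"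
      using col_space_eq[OF A] A X w by auto
    then have "col X k \<in> span (set (cols X) - {col X k})"
      by (simp add: col_space_def setA)
    moreover have "col X k \<in> set (cols X)" using k by (simp add: colsX)
    moreover have "set (cols X) \<subseteq> carrier_vec N" using X cols_dim by blast
    ultimately show False using lindep_span[of "set (cols X)"] iX by auto
  qed
qed

text \<open>Comparing sets of columns avoids tracking the index shift behind the deleted
  column.\<close>

lemma forall_cols_delete_col:
  assumes X: "X \<in> carrier_mat N K"
  shows "(\<forall>j<length (filter (\<lambda>j. j \<noteq> k) [0..<K]). P (col (delete_col X k) j)) \<longleftrightarrow>
    (\<forall>i<K. i \<noteq> k \<longrightarrow> P (col X i))"
proof -
  have "set (cols (delete_col X k)) = col X ` {i. i < K \<and> i \<noteq> k}"
    unfolding cols_delete_col[OF X] by auto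
  moreover have "set (cols (delete_col X k)) =
      col (delete_col X k) ` {..<length (filter (\<lambda>j. j \<noteq> k) [0..<K])}"
    using delete_col_carrier[OF X, of k] by (auto simp: cols_def)
  ultimately have "(\<forall>v\<in>col (delete_col X k) ` {..<length (filter (\<lambda>j. j \<noteq> k) [0..<K])}. P v) \<longleftrightarrow>
      (\<forall>v\<in>col X ` {i. i < K \<and> i \<noteq> k}. P v)" by simp
  then show ?thesis unfolding ball_simps by blast
qed

section \<open>The closed form of H and the case H = 1\<close>

text \<open>
  With total sum of squares \<open>T = x' x\<close>, centred sum of squares \<open>D\<close> and residual sum of squares
  \<open>r\<close>, one has \<open>I = T / D\<close> and \<open>C = D / r\<close>, so the centring cancels in \<open>H = T / r\<close>.
  Hence \<open>H = 1\<close> exactly when the fitted vector vanishes.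
\<close>

lemma H_index_eq:
  fixes X :: "real mat"
  assumes X: "X \<in> carrier_mat N K" and rank: "vec_space.rank N X = K"
    and k: "0 < k" "k < K" and ones: "col X 0 = ones_vec N"
  defines "x \<equiv> col X k" and "xh \<equiv> hat_mat (delete_col X k) *\<^sub>v col X k"
  shows "H_index X k = (x \<bullet> x) / (x \<bullet> x - xh \<bullet> xh)"
    and "x \<bullet> x - xh \<bullet> xh > 0"
proof -
  define m where "m = length (filter (\<lambda>j. j \<noteq> k) [0..<K])"
  interpret A: full_col_rank "delete_col X k" N m
    unfolding m_def by (rule delete_col_independent(1)[OF X rank k(2)])
  have x: "x \<in> carrier_vec N" using X by (auto simp: x_def)
  obtain w where w: "w \<in> carrier_vec m" "xh = delete_col X k *\<^sub>v w"
    using A.hat_mat_in_range[OF x] by (metis xh_def x_def)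
  have xh: "xh \<in> carrier_vec N" using w A.A by simp
  have "xh \<noteq> x"
    using delete_col_independent(2)[OF X rank k(2), folded m_def, OF w(1)] w(2) x_def by simp
  then have "x - xh \<noteq> 0\<^sub>v N" using x xh by (auto simp: vec_eq_iff)
  then have "(x - xh) \<bullet> (x - xh) \<noteq> 0"
    using scalar_prod_self_eq_0_iff[of "x - xh" N] x xh by simp
  then show r: "x \<bullet> x - xh \<bullet> xh > 0"
    using A.residual_norm(1)[OF x] scalar_prod_self_nonneg[of "x - xh"] by (simp add: xh_def x_def)
  \<comment> \<open>In dimension 0 every scalar product is an empty sum, contradicting
    \<open>r\<close>.\<close>
  have N: "0 < N"
    using r x xh by (cases N) (auto simp: scalar_prod_def)
  let ?e = "ones_vec N"
  let ?E = "mat_of_cols N [?e]"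
  interpret E: full_col_rank ?E N 1 by (rule full_col_rank_ones[OF N])
  have e: "?e \<in> carrier_vec N" by (simp add: ones_vec_def)
  have ee: "?e \<bullet> ?e = N" by (simp add: ones_vec_def scalar_prod_def)
  define S where "S = ?e \<bullet> x"
  \<comment> \<open>The normal equations make the residual orthogonal to every regressor. Since
    \<open>0 < k\<close>, the column e is among them, so x and its fitted vector share the sum
    \<open>S\<close>.\<close>
  have "(\<forall>j<m. col (delete_col X k) j \<bullet> (x - xh) = 0)"
  proof (intro allI impI)
    fix j assume j: "j < m"
    have "transpose_mat (delete_col X k) *\<^sub>v xh = transpose_mat (delete_col X k) *\<^sub>v x"
      using A.transpose_hat_mat[OF x] by (simp add: xh_def x_def)
    from arg_cong[OF this, of "\<lambda>v. v $ j"]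
    have "col (delete_col X k) j \<bullet> xh = col (delete_col X k) j \<bullet> x" using j A.A by simp
    then show "col (delete_col X k) j \<bullet> (x - xh) = 0"
      using x xh A.A j by (simp add: scalar_prod_minus_distrib[of _ N])
  qed
  then have "\<forall>i<K. i \<noteq> k \<longrightarrow> col X i \<bullet> (x - xh) = 0"
    unfolding m_def by (rule forall_cols_delete_col[OF X, THEN iffD1])
  then have "?e \<bullet> (x - xh) = 0" using k ones by auto
  then have Sh: "?e \<bullet> xh = S" using x xh e by (simp add: scalar_prod_minus_distrib[of _ N] S_def)
  \<comment> \<open>Stated for any vector with sum \<open>S\<close>, so that it covers both the
    numerator and the denominator of \<open>aux_R_sq\<close>.\<close>
  have centred: "v \<bullet> ((1\<^sub>m N - hat_mat ?E) *\<^sub>v v) = v \<bullet> v - S\<^sup>2 / N"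
    "v \<bullet> v - S\<^sup>2 / N \<ge> 0"
    if v: "v \<in> carrier_vec N" "?e \<bullet> v = S" for v
  proof -
    have hh: "(hat_mat ?E *\<^sub>v v) \<bullet> (hat_mat ?E *\<^sub>v v) = S\<^sup>2 / N"
      using e ee N v by (simp add: hat_mat_ones power2_eq_square)
    then show "v \<bullet> ((1\<^sub>m N - hat_mat ?E) *\<^sub>v v) = v \<bullet> v - S\<^sup>2 / N"
      using E.residual_norm(2)[OF v(1)] by simp
    show "v \<bullet> v - S\<^sup>2 / N \<ge> 0"
      using E.residual_norm(1)[OF v(1)] hh
        scalar_prod_self_nonneg[of "v - hat_mat ?E *\<^sub>v v"] by simp
  qed
  define D where "D = x \<bullet> x - S\<^sup>2 / N"
  \<comment> \<open>D is the residual sum of squares, positive by \<open>r\<close>, plus the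
    nonnegative centred sum of squares of the fitted vector.\<close>
  have D: "D > 0" using centred(2)[OF xh Sh] r by (simp add: D_def)
  have T: "x \<bullet> x > 0" using r scalar_prod_self_nonneg[of xh] by simp
  have "aux_R_sq X k = (xh \<bullet> xh - S\<^sup>2 / N) / D"
    using X centred(1)[OF xh Sh] centred(1)[OF x]
    by (simp add: aux_R_sq_def Let_def xh_def x_def D_def S_def)
  then have "1 - aux_R_sq X k = (x \<bullet> x - xh \<bullet> xh) / D"
    using D by (simp add: field_simps D_def)
  then have C: "collin_index X k = D / (x \<bullet> x - xh \<bullet> xh)" by (simp add: collin_index_def)
  have "x \<noteq> 0\<^sub>v N" using T x by auto
  then have "ineff_index X k = 1 / (1 - raw_corr_sq x)"
    using ineff_index_eq_raw_corr[of k X] X k by (simp add: x_def)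
  also have "raw_corr_sq x = S\<^sup>2 / ((x \<bullet> x) * N)"
    using x ee comm_scalar_prod[OF x e] by (simp add: raw_corr_sq_def S_def)
  also have "1 - S\<^sup>2 / ((x \<bullet> x) * N) = D / (x \<bullet> x)" using T N by (simp add: D_def field_simps)
  finally have "ineff_index X k = (x \<bullet> x) / D" by simp
  with C D show "H_index X k = (x \<bullet> x) / (x \<bullet> x - xh \<bullet> xh)" by (simp add: H_index_def)
qed

text \<open>A quotient T / (T - h'h) with positive denominator equals 1 exactly when h'h = 0, i.e.
  when the projection h vanishes.\<close>

lemma H_index_eq_1_iff:
  fixes X :: "real mat"
  assumes X: "X \<in> carrier_mat N K" and rank: "vec_space.rank N X = K"
    and k: "0 < k" "k < K" and ones: "col X 0 = ones_vec N"
  shows "H_index X k = 1 \<longleftrightarrow> (\<forall>i<K. i \<noteq> k \<longrightarrow> col X i \<bullet> col X k = 0)"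
proof -
  let ?h = "hat_mat (delete_col X k) *\<^sub>v col X k"
  let ?m = "length (filter (\<lambda>j. j \<noteq> k) [0..<K])"
  interpret A: full_col_rank "delete_col X k" N ?m
    by (rule delete_col_independent(1)[OF X rank k(2)])
  have x: "col X k \<in> carrier_vec N" using X by auto
  have "H_index X k = 1 \<longleftrightarrow> ?h \<bullet> ?h = 0"
    using H_index_eq[OF assms] by simp
  also have "\<dots> \<longleftrightarrow> ?h = 0\<^sub>v N"
    using x by (intro scalar_prod_self_eq_0_iff) (metis A.hat_mat_carrier mult_mat_vec_carrier)
  also have "\<dots> \<longleftrightarrow> (\<forall>j<?m. col (delete_col X k) j \<bullet> col X k = 0)"
    by (rule A.hat_mat_eq_0_iff[OF x])
  also have "\<dots> \<longleftrightarrow> (\<forall>i<K. i \<noteq> k \<longrightarrow> col X i \<bullet> col X k = 0)"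
    by (rule forall_cols_delete_col[OF X])
  finally show ?thesis .
qed

section \<open>Sample means and the diagonal Gram matrix\<close>

lemma sample_mean_eq:
  "sample_mean v = (ones_vec N \<bullet> v) / N" if "v \<in> carrier_vec N"
  using that by (simp add: sample_mean_def ones_vec_def scalar_prod_def atLeast0LessThan)

lemma ineff_index_eq_1:
  assumes X: "X \<in> carrier_mat N K" and k: "k < K" and nz: "col X k \<noteq> 0\<^sub>v N"
    and orth: "ones_vec N \<bullet> col X k = 0"
  shows "ineff_index X k = 1"
proof -
  have "col X k \<in> carrier_vec N" "ones_vec N \<in> carrier_vec N" using X by (auto simp: ones_vec_def)
  then have "col X k \<bullet> ones_vec N = 0" using orth comm_scalar_prod by metis
  then have "raw_corr_sq (col X k) = 0" using X by (simp add: raw_corr_sq_def)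
  then show ?thesis using ineff_index_eq_raw_corr[of k X] X k nz by simp
qed

theorem proposition2p1:
  fixes X :: "real mat" and N K :: nat
  assumes "2 \<le> K" and "K < N"
    and "X \<in> carrier_mat N K"
    and "vec_space.rank N X = K"
    and "col X 0 = ones_vec N"
  shows
    "(\<forall>k\<in>{1..<K}. H_index X k = 1 \<longleftrightarrow>
        sample_mean (col X k) = 0 \<and> (\<forall>i<K. i \<noteq> k \<longrightarrow> col X i \<bullet> col X k = 0))
   \<and> ((\<forall>k\<in>{1..<K}. H_index X k = 1) \<longleftrightarrow>
        (\<forall>k\<in>{1..<K}. sample_mean (col X k) = 0) \<and>
        transpose_mat X * X = mat_diag K (\<lambda>i. if i = 0 then real N else col X i \<bullet> col X i))
   \<and> (transpose_mat X * X = mat_diag K (\<lambda>i. if i = 0 then real N else col X i \<bullet> col X i) \<longrightarrow>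
        (\<forall>k\<in>{1..<K}. H_index X k = ineff_index X k \<and>
           ineff_index X k = 1 / (1 - raw_corr_sq (col X k))))"
proof -
  note X = assms(3) and rank = assms(4) and ones = assms(5)
  have col: "col X i \<in> carrier_vec N" for i using X by auto
  define orth where "orth k \<longleftrightarrow> (\<forall>i<K. i \<noteq> k \<longrightarrow> col X i \<bullet> col X k = 0)" for k
  define diag where "diag \<longleftrightarrow>
    transpose_mat X * X = mat_diag K (\<lambda>i. if i = 0 then real N else col X i \<bullet> col X i)"
  have H: "H_index X k = 1 \<longleftrightarrow> orth k" if "k \<in> {1..<K}" for k
    using H_index_eq_1_iff[OF X rank _ _ ones] that by (simp add: orth_def)
  have mean: "sample_mean (col X k) = 0" if "k \<in> {1..<K}" "orth k" for k
  proof -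
    have "col X 0 \<bullet> col X k = 0" using that by (auto simp: orth_def)
    then show ?thesis using sample_mean_eq[OF col] ones by simp
  qed
  have e: "ones_vec N \<bullet> ones_vec N = N" by (simp add: ones_vec_def scalar_prod_def)
  \<comment> \<open>Off-diagonal entries of X'X are the products in \<open>orth\<close>; the
    diagonal entry at 0 is e'e = N.\<close>
  have diag: "diag \<longleftrightarrow> (\<forall>k\<in>{1..<K}. orth k)"
  proof
    assume d: diag
    show "\<forall>k\<in>{1..<K}. orth k"
      unfolding orth_def
    proof (intro ballI allI impI)
      fix k i assume *: "k \<in> {1..<K}" "i < K" "i \<noteq> k"
      have "(transpose_mat X * X) $$ (i, k) = 0"
        using d * by (simp add: diag_def mat_diag_def)
      then show "col X i \<bullet> col X k = 0" using * X by simp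
    qed
  next
    assume o: "\<forall>k\<in>{1..<K}. orth k"
    have "col X i \<bullet> col X j = 0" if "i < K" "j < K" "i \<noteq> j" for i j
    \<comment> \<open>The assumption covers only k from 1 on, so products with e as second factor
      come from symmetry.\<close>
    proof (cases "j = 0")
      case True
      then have "col X j \<bullet> col X i = 0" using o that by (auto simp: orth_def)
      then show ?thesis using comm_scalar_prod[OF col col] by metis
    qed (use o that in \<open>auto simp: orth_def\<close>)
    then show diag
      unfolding diag_def using X ones e by (intro eq_matI) (auto simp: mat_diag_def)
  qed
  \<comment> \<open>If x_k were 0, the positive residual sum of squares would be -h'h, which is at
    most 0.\<close>
  have nz: "col X k \<noteq> 0\<^sub>v N" if k: "k \<in> {1..<K}" for k
  proof
    assume "col X k = 0\<^sub>v N"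
    then have "col X k \<bullet> col X k = 0" by simp
    moreover have "0 < k" "k < K" using k by auto
    note H_index_eq(2)[OF X rank this ones]
    ultimately show False
      using scalar_prod_self_nonneg[of "hat_mat (delete_col X k) *\<^sub>v col X k"] by simp
  qed
  have "H_index X k = ineff_index X k \<and> ineff_index X k = 1 / (1 - raw_corr_sq (col X k))"
    if "diag" and k: "k \<in> {1..<K}" for k
  proof -
    have o: "orth k" using that diag by blast
    then have "ones_vec N \<bullet> col X k = 0" using k ones by (auto simp: orth_def)
    then have "ineff_index X k = 1" using ineff_index_eq_1[OF X _ nz[OF k]] k by simp
    then show ?thesis
      using H[OF k] o ineff_index_eq_raw_corr[of k X] nz[OF k] X k by simp
  qed
  then show ?thesis
    using H mean diag unfolding diag_def[symmetric] orth_def[symmetric] by blast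
qed

end
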